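(* Let $\alpha\in(0,1)$. Suppose that, for every $\theta=(\tau,\beta_\tau,\sigma)$, the conditional distribution of $T(U,\theta)$ given $W(U,\theta)=w$ is free of $(\beta_\tau,\sigma)$ (i.e. it depends only on $\tau$ and $w$), and that the sets $B_\alpha(\tau,w)$ satisfy $$\mathbb P_{U|W}\{T(U,\theta)\in B_\alpha(\tau,w)\mid W(U,\theta)=w\}\ge\alpha$$ for all $\theta=(\tau,\beta_\tau,\sigma)$ and $w$. Then $\mathbb P(\tau_0\in\Gamma_\alpha^\tau(Y))\ge\alpha$, where $$\begin{aligned}\Gamma_\alpha^\tau(y)=\big\{\tau\subset[p]:\ &\exists\,u^*\in\mathbb R^n\text{ and }(\beta_\tau,\sigma)\text{ such that } y=X_\tau\beta_\tau+\sigma u^*\text{ and }\\ &T(u^*,\theta)\in B_\alpha(\tau,W(u^*,\theta)),\ \theta=(\tau,\beta_\tau,\sigma)\big\}.\end{aligned}$$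
   Context: Setting. $X\in\mathbb R^{n\times p}$ is a fixed matrix; for $\tau\subset[p]=\{1,\dots,p\}$ (a "model"), $X_\tau$ is the submatrix of columns indexed by $\tau$, and $|\tau|$ is its cardinality. The data are $Y=X_{\tau_0}\beta_0+\sigma_0U$ with $U\sim N(0,I_n)$ and $\tau_0\subset[p]$, $\beta_0\in\mathbb R^{|\tau_0|}$, $\sigma_0>0$ fixed. For a generic parameter $\theta=(\tau,\beta_\tau,\sigma)$ with $\tau\subset[p]$, $\beta_\tau\in\mathbb R^{|\tau|}$, $\sigma>0$, and $u\in\mathbb R^n$, put $y_\theta=X_\tau\beta_\tau+\sigma u$. The nuclear mapping is $$T(u,\theta)=\hat\tau(y_\theta),\qquad \hat\tau(y_\theta)=\arg\min_{\tilde\tau\subset[p],\,|\tilde\tau|\le|\tau|}\ \min_{\beta_{\tilde\tau}\in\mathbb R^{|\tilde\tau|}}\|y_\theta-X_{\tilde\tau}\beta_{\tilde\tau}\|^2$$ (with a fixed tie-breaking rule), so $T$ takes values in the set $\mathcal M=2^{[p]}$ of models. $W(u,\theta)$ is a (measurable) function of $(u,\theta)$, and for each $\tau$ and each value $w$ of $W$, $B_\alpha(\tau,w)\subset\mathcal M$ is a set depending on $\tau$ and $w$ but not on $(\beta_\tau,\sigma)$. *)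

theory Defs
  imports "HOL-Probability.Probability"
begin

text \<open>
  A model is a set of column indices. A coefficient vector indexed by \<open>\<tau>\<close> is an extensional
  function in \<open>\<tau> \<rightarrow>\<^sub>E UNIV\<close>, i.e. a point of \<open>space (Pi\<^sub>M \<tau> (\<lambda>_. borel))\<close>, so that each point
  of the Euclidean space of dimension \<open>card \<tau>\<close> is represented exactly once.
\<close>

type_synonym 'p param = "'p set \<times> ('p \<Rightarrow> real) \<times> real"

definition params :: "'p param set" where
  "params = {(\<tau>, \<beta>, \<sigma>). \<beta> \<in> \<tau> \<rightarrow>\<^sub>E UNIV \<and> \<sigma> > 0}"

definition submatrix_mult :: "real ^ 'p ^ 'n \<Rightarrow> 'p set \<Rightarrow> ('p \<Rightarrow> real) \<Rightarrow> real ^ 'n" where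
  "submatrix_mult X \<tau> \<beta> = (\<Sum>j\<in>\<tau>. \<beta> j *\<^sub>R column j X)"

definition response :: "real ^ 'p ^ 'n \<Rightarrow> 'p param \<Rightarrow> real ^ 'n \<Rightarrow> real ^ 'n" where
  "response X \<theta> u = (case \<theta> of (\<tau>, \<beta>, \<sigma>) \<Rightarrow> submatrix_mult X \<tau> \<beta> + \<sigma> *\<^sub>R u)"

text \<open>The infimum is attained (by a projection of \<open>y\<close> onto the column span), hence a minimum.\<close>

definition least_squares :: "real ^ 'p ^ 'n \<Rightarrow> real ^ 'n \<Rightarrow> 'p set \<Rightarrow> real" where
  "least_squares X y \<tau> = (INF \<beta>\<in>\<tau> \<rightarrow>\<^sub>E UNIV. (norm (y - submatrix_mult X \<tau> \<beta>))\<^sup>2)"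

text \<open>The argument \<open>tie\<close> is the tie-breaking rule: it picks one model from the set of minimizers.\<close>

definition model_estimate ::
  "real ^ 'p ^ 'n \<Rightarrow> ('p set set \<Rightarrow> 'p set) \<Rightarrow> nat \<Rightarrow> real ^ 'n \<Rightarrow> 'p set" where
  "model_estimate X tie k y = tie {\<tau>. is_arg_min (least_squares X y) (\<lambda>\<tau>'. card \<tau>' \<le> k) \<tau>}"

definition nuclear_map ::
  "real ^ 'p ^ 'n \<Rightarrow> ('p set set \<Rightarrow> 'p set) \<Rightarrow> real ^ 'n \<Rightarrow> 'p param \<Rightarrow> 'p set" where
  "nuclear_map X tie u \<theta> = model_estimate X tie (card (fst \<theta>)) (response X \<theta> u)"

text \<open>
  For a fixed model \<open>\<tau>\<close>, the set of all \<open>y\<close> with \<open>\<tau> \<in> confidence_set X tie W B y\<close> is a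
  projection of a measurable set along \<open>(\<beta>, \<sigma>)\<close> when \<open>W\<close> and \<open>B\<close> are measurable. Such a set
  is analytic and need not be Borel, so its probability is to be taken in the completion.
\<close>

definition confidence_set ::
  "real ^ 'p ^ 'n \<Rightarrow> ('p set set \<Rightarrow> 'p set) \<Rightarrow> (real ^ 'n \<Rightarrow> 'p param \<Rightarrow> 'w) \<Rightarrow>
   ('p set \<Rightarrow> 'w \<Rightarrow> 'p set set) \<Rightarrow> real ^ 'n \<Rightarrow> 'p set set" where
  "confidence_set X tie W B y =
     {\<tau>. \<exists>u \<beta> \<sigma>. (\<tau>, \<beta>, \<sigma>) \<in> params \<and> y = response X (\<tau>, \<beta>, \<sigma>) u \<and>
          nuclear_map X tie u (\<tau>, \<beta>, \<sigma>) \<in> B \<tau> (W u (\<tau>, \<beta>, \<sigma>))}"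

text \<open>
  \<open>K w\<close> is (a version of) the conditional distribution of the discrete random element \<open>S\<close>
  given \<open>V = w\<close>, where \<open>V\<close> takes values in \<open>N\<close>.
\<close>

definition is_cond_distr ::
  "'a measure \<Rightarrow> ('a \<Rightarrow> 's) \<Rightarrow> 'w measure \<Rightarrow> ('a \<Rightarrow> 'w) \<Rightarrow> ('w \<Rightarrow> 's measure) \<Rightarrow> bool" where
  "is_cond_distr M S N V K \<longleftrightarrow>
     S \<in> M \<rightarrow>\<^sub>M count_space UNIV \<and> V \<in> M \<rightarrow>\<^sub>M N \<and>
     K \<in> N \<rightarrow>\<^sub>M prob_algebra (count_space UNIV) \<and>
     (\<forall>A. \<forall>D\<in>sets N.
        emeasure M {\<omega>\<in>space M. S \<omega> \<in> A \<and> V \<omega> \<in> D} =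
        (\<integral>\<^sup>+ w\<in>D. emeasure (K w) A \<partial>(distr M N V)))"

end

theory Submission imports Defs begin

text \<open>
  The true noise \<open>U\<close> is a witness: if \<open>T(U, \<theta>\<^sub>0) \<in> B(\<tau>\<^sub>0, W(U, \<theta>\<^sub>0))\<close> then \<open>\<tau>\<^sub>0\<close> lies in the
  confidence set of \<open>Y\<close>, and the former event has probability at least \<open>\<alpha>\<close> by integrating the
  conditional bound. What remains is that the larger event is measurable for the completion.
  It is the preimage under \<open>Y\<close> of the projection along \<open>(\<beta>, \<sigma>)\<close> of a Borel set, and such
  projections are universally measurable. To see this, represent Borel sets as projections of
  closed sets along the Baire space \<open>nat \<Rightarrow> nat\<close>, and exhaust the outer measure of the projection
  from inside by closed sets, bounding one Baire coordinate at a time.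
\<close>

section \<open>Projections of Borel sets\<close>

text \<open>Suslin's form of analyticity, with witnesses in the Baire space. One point of that space
  can carry a number together with a sequence, or countably many sequences at once; countable unions
  and intersections rest on this coding.\<close>

definition analytic :: "'a::topological_space set \<Rightarrow> bool" where
  "analytic A \<longleftrightarrow> (\<exists>F :: ('a \<times> (nat \<Rightarrow> nat)) set. closed F \<and> A = fst ` F)"

lemma analyticI:
  assumes "closed {p :: 'a::topological_space \<times> (nat \<Rightarrow> nat). P (fst p) (snd p)}"
    and "\<And>z. z \<in> A \<longleftrightarrow> (\<exists>x. P z x)"
  shows "analytic A"
  unfolding analytic_def
proof (intro exI conjI)
  show "A = fst ` {p. P (fst p) (snd p)}"
    using assms(2) by (auto simp: image_iff)
qed (fact assms(1))

lemma analyticE: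
  fixes A :: "'a::topological_space set"
  assumes "analytic A"
  obtains P :: "'a \<Rightarrow> (nat \<Rightarrow> nat) \<Rightarrow> bool"
  where "closed {p. P (fst p) (snd p)}" and "\<And>z. z \<in> A \<longleftrightarrow> (\<exists>x. P z x)"
proof -
  obtain F where F: "closed (F :: ('a \<times> (nat \<Rightarrow> nat)) set)" "A = fst ` F"
    using assms by (auto simp: analytic_def)
  show ?thesis
  proof (rule that)
    show "closed {p. (fst p, snd p) \<in> F}"
      using F by simp
    show "z \<in> A \<longleftrightarrow> (\<exists>x. (z, x) \<in> F)" for z
      using F by (auto simp: image_iff Bex_def)
  qed
qed

lemma analytic_familyE:
  fixes A :: "'i \<Rightarrow> 'a::topological_space set"
  assumes "\<And>n. analytic (A n)"
  obtains P :: "'i \<Rightarrow> 'a \<Rightarrow> (nat \<Rightarrow> nat) \<Rightarrow> bool"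
  where "\<And>n. closed {p. P n (fst p) (snd p)}" and "\<And>n z. z \<in> A n \<longleftrightarrow> (\<exists>x. P n z x)"
proof -
  have "\<exists>P. closed {p. P (fst p) (snd p)} \<and> (\<forall>z. z \<in> A n \<longleftrightarrow> (\<exists>x :: nat \<Rightarrow> nat. P z x))" for n
    by (rule analyticE[OF assms[of n]]) blast
  then have "\<forall>n. \<exists>P. closed {p. P (fst p) (snd p)} \<and> (\<forall>z. z \<in> A n \<longleftrightarrow> (\<exists>x :: nat \<Rightarrow> nat. P z x))"
    by blast
  from choice[OF this] that show ?thesis
    by blast
qed

lemma closed_imp_analytic:
  assumes "closed A"
  shows "analytic A"
proof (rule analyticI)
  show "closed {p :: 'a \<times> (nat \<Rightarrow> nat). fst p \<in> A}"
    using closed_vimage_fst[OF assms] by (simp add: vimage_def)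
qed simp

lemma continuous_on_snd_apply:
  "continuous_on UNIV (\<lambda>p :: 'a::topological_space \<times> ('i \<Rightarrow> 'b::topological_space). snd p i)"
  by (rule continuous_on_product_then_coordinatewise[OF continuous_on_snd[OF continuous_on_id]])

lemma continuous_on_reindex:
  "continuous_on UNIV
    (\<lambda>p :: 'a::topological_space \<times> ('i \<Rightarrow> 'b::topological_space). (fst p, \<lambda>k. snd p (h k)))"
  by (intro continuous_on_Pair continuous_on_fst continuous_on_id
      continuous_on_coordinatewise_then_product continuous_on_snd_apply)

text \<open>Reading off the coordinates \<open>h k\<close> of a Baire point is continuous. Closed
  conditions on a decoded sequence are thus closed conditions on its code.\<close>

lemma closed_reindex:
  fixes P :: "'a::topological_space \<Rightarrow> (nat \<Rightarrow> nat) \<Rightarrow> bool" and h :: "nat \<Rightarrow> nat"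
  assumes "closed {p. P (fst p) (snd p)}"
  shows "closed {p. P (fst p) (\<lambda>k. snd p (h k))}"
  using closed_vimage[OF assms continuous_on_reindex[of h]] by (simp add: vimage_def)

text \<open>A witness for the union is coded as one sequence: coordinate 0 names the index
  \<open>n\<close>, and the tail is a witness for \<open>A n\<close>.\<close>

lemma analytic_UN:
  fixes A :: "nat \<Rightarrow> 'a::topological_space set"
  assumes "\<And>n. analytic (A n)"
  shows "analytic (\<Union>n. A n)"
proof -
  obtain P :: "nat \<Rightarrow> 'a \<Rightarrow> (nat \<Rightarrow> nat) \<Rightarrow> bool"
    where cl: "\<And>n. closed {p. P n (fst p) (snd p)}"
    and A: "\<And>n z. z \<in> A n \<longleftrightarrow> (\<exists>x. P n z x)"
    by (rule analytic_familyE[of A, OF assms]) (rule that)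
  show ?thesis
  proof (rule analyticI)
    \<comment> \<open>The index varies with \<open>p\<close>, so the condition is rewritten as one
      implication per fixed \<open>n\<close>. Its premise is clopen, because coordinate 0 ranges
      over a discrete space.\<close>
    have eq: "{p. P (snd p 0) (fst p) (\<lambda>k. snd p (Suc k))} =
       (\<Inter>n. {p. snd p 0 \<noteq> n} \<union> {p. P n (fst p) (\<lambda>k. snd p (Suc k))})" by blast
    have "closed {p :: 'a \<times> (nat \<Rightarrow> nat). snd p 0 \<noteq> n}" for n
    proof -
      have "closed ((\<lambda>p :: 'a \<times> (nat \<Rightarrow> nat). snd p 0) -` (- {n}))"
        by (intro closed_vimage continuous_on_snd_apply) (simp add: closed_def discrete_topology_class.open_discrete)
      then show ?thesis by (simp add: vimage_def)
    qed
    moreover have "closed {p. P n (fst p) (\<lambda>k. snd p (Suc k))}" for n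
      by (rule closed_reindex[OF cl])
    ultimately show "closed {p. P (snd p 0) (fst p) (\<lambda>k. snd p (Suc k))}"
      unfolding eq by (auto intro!: closed_INT)
  next
    fix z
    have "\<exists>x. P (x 0) z (\<lambda>k. x (Suc k))" if "P n z y" for n y
      by (rule exI[of _ "case_nat n y"]) (use that in simp)
    then show "z \<in> (\<Union>n. A n) \<longleftrightarrow> (\<exists>x. P (x 0) z (\<lambda>k. x (Suc k)))"
      using A by blast
  qed
qed

text \<open>One Baire point is cut into countably many blocks by \<open>prod_encode\<close>. The
  blocks are disjoint, so the witnesses for different \<open>n\<close> can be chosen independently
  and glued.\<close>

lemma analytic_INT:
  fixes A :: "nat \<Rightarrow> 'a::topological_space set"
  assumes "\<And>n. analytic (A n)"
  shows "analytic (\<Inter>n. A n)"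
proof -
  obtain P :: "nat \<Rightarrow> 'a \<Rightarrow> (nat \<Rightarrow> nat) \<Rightarrow> bool"
    where cl: "\<And>n. closed {p. P n (fst p) (snd p)}"
    and A: "\<And>n z. z \<in> A n \<longleftrightarrow> (\<exists>x. P n z x)"
    by (rule analytic_familyE[of A, OF assms]) (rule that)
  show ?thesis
  proof (rule analyticI)
    have eq: "{p. \<forall>n. P n (fst p) (\<lambda>k. snd p (prod_encode (n, k)))} =
       (\<Inter>n. {p. P n (fst p) (\<lambda>k. snd p (prod_encode (n, k)))})"
      by (rule Collect_all_eq)
    have "closed {p. P n (fst p) (\<lambda>k. snd p (prod_encode (n, k)))}" for n
      by (rule closed_reindex[OF cl])
    then show "closed {p. \<forall>n. P n (fst p) (\<lambda>k. snd p (prod_encode (n, k)))}"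
      unfolding eq by blast
  next
    fix z
    show "z \<in> (\<Inter>n. A n) \<longleftrightarrow> (\<exists>x. \<forall>n. P n z (\<lambda>k. x (prod_encode (n, k))))"
    proof
      assume "z \<in> (\<Inter>n. A n)"
      then have "\<forall>n. \<exists>x. P n z x"
        using A by blast
      then obtain y where y: "\<And>n. P n z (y n)"
        by metis
      show "\<exists>x. \<forall>n. P n z (\<lambda>k. x (prod_encode (n, k)))"
        by (rule exI[of _ "\<lambda>i. case prod_decode i of (n, k) \<Rightarrow> y n k"]) (simp add: y)
    next
      assume "\<exists>x. \<forall>n. P n z (\<lambda>k. x (prod_encode (n, k)))"
      then show "z \<in> (\<Inter>n. A n)"
        using A by blast
    qed
  qed
qed

lemma open_imp_analytic:
  fixes S :: "'a::metric_space set"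
  assumes "open S"
  shows "analytic S"
proof -
  have "fsigma_in euclidean S"
    using assms by (intro open_imp_fsigma_in) (auto simp: metrizable_space_euclidean)
  then obtain C where "\<And>n::nat. closed (C n)" "(\<Union>n. C n) = S"
    by (auto simp: fsigma_in_ascending)
  then show ?thesis
    using analytic_UN[of C] closed_imp_analytic by metis
qed

lemma borel_imp_analytic:
  fixes A :: "'a::metric_space set"
  assumes "A \<in> sets borel"
  shows "analytic A"
proof -
  have "A \<in> sigma_sets UNIV {S. open S}"
    using assms by (simp add: borel_def)
  \<comment> \<open>Complements do not preserve analyticity by itself, but they swap the two halves
    of this conjunction. In the union step, the half for the complement becomes a countable
    intersection.\<close>
  then have "analytic A \<and> analytic (- A)"
  proof induction
    case (Basic S)
    then show ?case
      by (auto simp: open_imp_analytic intro!: closed_imp_analytic)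
  next
    case (Union A)
    then show ?case
      by (auto intro!: analytic_UN analytic_INT simp: Compl_UN)
  qed (auto simp: Compl_eq_Diff_UNIV[symmetric] intro: closed_imp_analytic)
  then show ?thesis ..
qed

section \<open>Inner approximation by closed sets and universal measurability\<close>

text \<open>Tychonoff: the set is a product of finite sets.\<close>

lemma compact_Collect_le:
  fixes m :: "nat \<Rightarrow> nat"
  shows "compact {x. \<forall>i. x i \<le> m i}"
proof -
  have "compactin (product_topology (\<lambda>_. euclidean) UNIV) (Pi\<^sub>E UNIV (\<lambda>i. {..m i}))"
    by (simp add: compactin_PiE finite_imp_compact)
  moreover have "Pi\<^sub>E UNIV (\<lambda>i. {..m i}) = {x. \<forall>i. x i \<le> m i}"
    by (auto simp: PiE_def Pi_def)
  ultimately show ?thesis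
    by (simp add: euclidean_product_topology)
qed

text \<open>Outer measure is continuous along increasing sequences of arbitrary sets, so if
  \<open>D l\<close> exceeds \<open>c\<close>, some \<open>D (l @ [j])\<close> already does.
  Iterating the choice of \<open>j\<close> produces \<open>m\<close>, with no measurability demanded
  of any \<open>D l\<close>.\<close>

lemma outer_measure_of_scheme:
  fixes D :: "nat list \<Rightarrow> 'a set"
  assumes sp: "\<And>l. D l \<subseteq> space M"
    and inc: "\<And>l. incseq (\<lambda>j. D (l @ [j]))"
    and un: "\<And>l. D l = (\<Union>j. D (l @ [j]))"
    and c: "c < outer_measure_of M (D [])"
  obtains m :: "nat \<Rightarrow> nat" where "\<And>k. c < outer_measure_of M (D (map m [0..<k]))"
proof -
  have step: "\<exists>j. c < outer_measure_of M (D (l @ [j]))" if "c < outer_measure_of M (D l)" for l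
  proof -
    have "outer_measure_of M (D l) = (SUP j. outer_measure_of M (D (l @ [j])))"
      by (subst un, rule SUP_outer_measure_of_incseq[symmetric]) (use sp inc in auto)
    with that show ?thesis
      by (simp add: less_SUP_iff)
  qed
  define nxt where "nxt l = (SOME j. c < outer_measure_of M (D (l @ [j])))" for l
  \<comment> \<open>Each choice depends on all earlier ones, so the recursion runs over the prefixes
    \<open>L k\<close>, and \<open>m\<close> is read off afterwards.\<close>
  define L where "L = rec_nat [] (\<lambda>_ l. l @ [nxt l])"
  define m where "m k = nxt (L k)" for k
  have L: "L 0 = []" "L (Suc k) = L k @ [nxt (L k)]" for k
    by (simp_all add: L_def)
  have "L k = map m [0..<k]" for k
    by (induction k) (simp_all add: L m_def)
  moreover have "c < outer_measure_of M (D (L k))" for k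
  proof (induction k)
    case (Suc k)
    then show ?case
      unfolding L nxt_def by (rule someI_ex[OF step])
  qed (simp add: L c)
  ultimately have "c < outer_measure_of M (D (map m [0..<k]))" for k
    by metis
  then show ?thesis
    by (rule that)
qed

text \<open>Choquet's capacitability argument. Successive bounds give decreasing sets
  \<open>E k\<close> of outer measure above \<open>c\<close>, and the intersection of their closures
  keeps measure at least \<open>c\<close>. Taking closures adds nothing outside the projection: a
  point of the intersection is a limit of points with increasingly bounded witnesses, and a
  subsequence of these witnesses converges.\<close>

lemma analytic_fst_inner_approx:
  fixes S :: "('a::metric_space \<times> 'b::heine_borel) set"
  assumes S: "analytic S" and M: "finite_measure M" "sets M = sets borel"
    and c: "c < outer_measure_of M (fst ` S)"
  shows "\<exists>C. closed C \<and> C \<subseteq> fst ` S \<and> c \<le> emeasure M C"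
proof -
  interpret finite_measure M by fact
  have space: "space M = UNIV"
    using sets_eq_imp_space_eq[OF M(2)] by simp
  obtain P :: "'a \<times> 'b \<Rightarrow> (nat \<Rightarrow> nat) \<Rightarrow> bool"
    where cl: "closed {p. P (fst p) (snd p)}" and S_iff: "\<And>z. z \<in> S \<longleftrightarrow> (\<exists>x. P z x)"
    by (rule analyticE[OF S]) (rule that)
  \<comment> \<open>Bounding the values of \<open>b q x\<close> confines \<open>(q, x)\<close> to a compact set.\<close>
  define b where "b q x i = max (x i) (nat \<lceil>dist undefined q\<rceil>)"
    for q :: 'b and x :: "nat \<Rightarrow> nat" and i :: nat
  \<comment> \<open>Only the first \<open>length l\<close> values are bounded, so
    \<open>D []\<close> is the whole projection and the sets \<open>D (l @ [j])\<close> exhaust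
    \<open>D l\<close> as \<open>j\<close> grows.\<close>
  define D where "D l = {y. \<exists>q x. P (y, q) x \<and> (\<forall>i<length l. b q x i \<le> l ! i)}" for l
  have D_snoc: "y \<in> D (l @ [j]) \<longleftrightarrow>
      (\<exists>q x. P (y, q) x \<and> (\<forall>i<length l. b q x i \<le> l ! i) \<and> b q x (length l) \<le> j)" for y l j
    by (simp add: D_def nth_append All_less_Suc conj_commute)
  have inc: "incseq (\<lambda>j. D (l @ [j]))" for l
    by (rule incseq_SucI, rule subsetI, unfold D_snoc) (meson le_SucI)
  have un: "D l = (\<Union>j. D (l @ [j]))" for l
  proof (rule set_eqI)
    show "y \<in> D l \<longleftrightarrow> y \<in> (\<Union>j. D (l @ [j]))" for y
      unfolding UN_iff D_snoc by (auto simp: D_def)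
  qed
  have D0: "D [] = fst ` S"
    by (auto simp: D_def S_iff image_iff Bex_def) blast
  obtain m where m: "\<And>k. c < outer_measure_of M (D (map m [0..<k]))"
  proof (rule outer_measure_of_scheme[of D M c, OF _ inc un])
    show "c < outer_measure_of M (D [])" using c by (simp only: D0)
  qed (auto simp: space intro: that)
  define E where "E k = D (map m [0..<k])" for k
  have E_iff: "y \<in> E k \<longleftrightarrow> (\<exists>q x. P (y, q) x \<and> (\<forall>i<k. b q x i \<le> m i))" for y k
    by (simp add: E_def D_def)
  define C where "C = (\<Inter>k. closure (E k))"
  have decE: "decseq E"
    by (rule decseq_SucI, rule subsetI, unfold E_iff) (meson less_SucI)
  have "c \<le> (INF k. emeasure M (closure (E k)))"
  proof (rule INF_greatest)
    fix k
    have "c < outer_measure_of M (E k)" using m by (simp add: E_def)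
    also have "\<dots> \<le> outer_measure_of M (closure (E k))"
      by (intro outer_measure_of_mono closure_subset)
    also have "\<dots> = emeasure M (closure (E k))"
      by (simp add: M)
    finally show "c \<le> emeasure M (closure (E k))" by simp
  qed
  also have "\<dots> = emeasure M C"
    unfolding C_def using decE
    by (intro INF_emeasure_decseq) (auto simp: M decseq_def intro: closure_mono[THEN subsetD])
  finally have "c \<le> emeasure M C" .
  moreover have "C \<subseteq> fst ` S"
  proof
    fix y assume y: "y \<in> C"
    \<comment> \<open>With \<open>E (Suc k)\<close> in place of \<open>E k\<close>, index 0 is
      bounded for every \<open>k\<close>, and that single bound keeps all the \<open>q k\<close> in
      one ball.\<close>
    have "\<exists>y' q x. dist y' y < inverse (Suc k) \<and> P (y', q) x \<and> (\<forall>i<Suc k. b q x i \<le> m i)" for k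
    proof -
      have "y \<in> closure (E (Suc k))" using y by (simp add: C_def)
      then obtain y' where "y' \<in> E (Suc k)" "dist y' y < inverse (Suc k)"
        unfolding closure_approachable by (meson inverse_positive_iff_positive of_nat_0_less_iff zero_less_Suc)
      then show ?thesis unfolding E_iff by blast
    qed
    then obtain Y q x where Y: "\<And>k. dist (Y k) y < inverse (Suc k)"
      and P: "\<And>k. P (Y k, q k) (x k)"
      and b: "\<And>k i. i < Suc k \<Longrightarrow> b (q k) (x k) i \<le> m i"
      by metis
    have x: "x k i \<le> m i" if "i < Suc k" for k i
      using b[OF that] by (simp add: b_def)
    have q: "dist undefined (q k) \<le> m 0" for k
      using b[of 0 k] by (simp add: b_def)
    \<comment> \<open>\<open>x k\<close> is bounded by \<open>m\<close> in the first coordinates only; truncating the others gives compactness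
      and does not change the coordinatewise limits.\<close>
    define x' where "x' k i = min (x k i) (m i)" for k i
    have "seq_compact (cball undefined (m 0) \<times> {x. \<forall>i. x i \<le> m i} :: ('b \<times> (nat \<Rightarrow> nat)) set)"
      by (intro compact_imp_seq_compact compact_Times compact_cball compact_Collect_le)
    moreover have "\<forall>k. (q k, x' k) \<in> cball undefined (m 0) \<times> {x. \<forall>i. x i \<le> m i}"
      using q by (simp add: x'_def)
    ultimately obtain l r where r: "strict_mono r" and lim: "((\<lambda>k. (q k, x' k)) \<circ> r) \<longlonglongrightarrow> l"
      by (rule seq_compactE)
    have lim_q: "(\<lambda>k. q (r k)) \<longlonglongrightarrow> fst l"
      using tendsto_fst[OF lim] by (simp add: o_def)
    have lim_x': "(\<lambda>k. x' (r k)) \<longlonglongrightarrow> snd l"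
      using tendsto_snd[OF lim] by (simp add: o_def)
    have "(\<lambda>k. x (r k) i) \<longlonglongrightarrow> snd l i" for i
    proof (rule Lim_transform_eventually)
      show "(\<lambda>k. x' (r k) i) \<longlonglongrightarrow> snd l i"
        using continuous_on_tendsto_compose[OF continuous_on_product_coordinates lim_x'] by simp
      show "\<forall>\<^sub>F k in sequentially. x' (r k) i = x (r k) i"
        using eventually_ge_at_top[of i]
      proof eventually_elim
        case (elim k)
        then have "i < Suc (r k)"
          using seq_suble[OF r, of k] by simp
        then show ?case
          using x by (simp add: x'_def min_def)
      qed
    qed
    then have lim_x: "(\<lambda>k. x (r k)) \<longlonglongrightarrow> snd l"
      using limitin_componentwise[of "\<lambda>_. euclidean" UNIV "\<lambda>k. x (r k)" "snd l" sequentially]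
      by (simp add: euclidean_product_topology)
    have "(\<lambda>k. dist (Y k) y) \<longlonglongrightarrow> 0"
    proof (rule tendsto_sandwich[OF _ _ tendsto_const LIMSEQ_inverse_real_of_nat])
      show "\<forall>\<^sub>F k in sequentially. dist (Y k) y \<le> inverse (real (Suc k))"
        by (intro always_eventually allI less_imp_le Y)
    qed simp
    then have "Y \<longlonglongrightarrow> y"
      by (rule iffD2[OF tendsto_dist_iff])
    then have lim_Y: "(\<lambda>k. Y (r k)) \<longlonglongrightarrow> y"
      using LIMSEQ_subseq_LIMSEQ[OF _ r] by (simp add: o_def)
    \<comment> \<open>The relation is closed, so the limit \<open>l\<close> of the witnesses is
      itself a witness for \<open>y\<close>.\<close>
    have "((y, fst l), snd l) \<in> {p. P (fst p) (snd p)}"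
      using cl
      by (rule closed_sequentially[where f = "\<lambda>k. ((Y (r k), q (r k)), x (r k))"])
         (auto simp: P intro!: tendsto_Pair lim_Y lim_q lim_x)
    then show "y \<in> fst ` S"
      using S_iff by force
  qed
  moreover have "closed C" unfolding C_def by (intro closed_INT ballI closed_closure)
  ultimately show ?thesis by blast
qed

text \<open>A measurable hull from outside and a countable union of closed sets from inside have the
  same finite measure, and they sandwich the projection.\<close>

lemma fst_borel_in_completion:
  fixes S :: "('a::metric_space \<times> 'b::heine_borel) set"
  assumes S: "S \<in> sets borel" and M: "finite_measure M" "sets M = sets borel"
  shows "fst ` S \<in> sets (completion M)"
proof -
  interpret finite_measure M by fact
  have space: "space M = UNIV"
    using sets_eq_imp_space_eq[OF M(2)] by simp
  obtain T where T: "T \<in> sets M" "fst ` S \<subseteq> T" "outer_measure_of M (fst ` S) = emeasure M T"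
    using outer_measure_of_attain[of "fst ` S" M] space by auto
  show ?thesis
  \<comment> \<open>A null hull is treated apart: the approximating levels \<open>f n\<close> must
    lie strictly below \<open>emeasure M T\<close>.\<close>
  proof (cases "emeasure M T = 0")
    case True
    then show ?thesis
      using T by (intro sets_completionI_sub[of T]) auto
  next
    case False
    define a where "a = emeasure M T"
    have a: "0 < a" "a < \<infinity>"
      using False by (auto simp: a_def zero_less_iff_neq_zero less_top[symmetric])
    obtain f :: "nat \<Rightarrow> ennreal" where f: "\<And>n. f n < a" "f \<longlonglongrightarrow> a"
      using approx_from_below_dense_linorder[OF a(1)] by blast
    have "\<exists>C. closed C \<and> C \<subseteq> fst ` S \<and> f n \<le> emeasure M C" for n
      using f(1)[of n] T(3) by (intro analytic_fst_inner_approx borel_imp_analytic S M) (simp add: a_def)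
    then obtain C where C: "\<And>n. closed (C n)" "\<And>n. C n \<subseteq> fst ` S" "\<And>n. f n \<le> emeasure M (C n)"
      by metis
    have CM: "C n \<in> sets M" for n
      using C(1) by (simp add: M)
    have "a \<le> emeasure M (\<Union>n. C n)"
    proof (rule LIMSEQ_le_const2[OF f(2)], intro exI allI impI)
      fix n
      have "f n \<le> emeasure M (C n)" by (rule C)
      also have "\<dots> \<le> emeasure M (\<Union>n. C n)"
        by (intro emeasure_mono sets.countable_UN') (auto simp: CM)
      finally show "f n \<le> emeasure M (\<Union>n. C n)" .
    qed
    moreover have "emeasure M (\<Union>n. C n) \<le> a"
      unfolding a_def using C(2) T by (intro emeasure_mono) auto
    ultimately have "emeasure M (\<Union>n. C n) = emeasure M T"
      by (simp add: a_def)
    moreover have "(\<Union>n. C n) \<in> sets M"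
      by (intro sets.countable_UN') (auto simp: CM)
    moreover have "(\<Union>n. C n) \<subseteq> fst ` S"
      using C(2) by blast
    ultimately show ?thesis
      using T a(2)
      by (simp add: completion.complete_sets_sandwich[of "\<Union>n. C n" M T "fst ` S"] a_def)
  qed
qed

section \<open>The confidence event\<close>

text \<open>The disintegration formula speaks of a fixed set \<open>A\<close>, whereas
  \<open>b (V \<omega>)\<close> is random. As \<open>b\<close> has finitely many possible values,
  the event splits into pieces on which the set is constant.\<close>

lemma cond_distr_level:
  fixes S :: "'a \<Rightarrow> 's::finite" and b :: "'w \<Rightarrow> 's set"
  assumes "prob_space M" and cd: "is_cond_distr M S N V K"
    and b: "b \<in> N \<rightarrow>\<^sub>M count_space UNIV"
    and level: "\<And>w. w \<in> space N \<Longrightarrow> \<alpha> \<le> measure (K w) (b w)"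
  shows "{\<omega>\<in>space M. S \<omega> \<in> b (V \<omega>)} \<in> sets M" (is "?G \<in> _")
    and "\<alpha> \<le> measure M {\<omega>\<in>space M. S \<omega> \<in> b (V \<omega>)}"
proof -
  interpret prob_space M by fact
  have S: "S \<in> M \<rightarrow>\<^sub>M count_space UNIV" and V: "V \<in> M \<rightarrow>\<^sub>M N"
    and K: "K \<in> N \<rightarrow>\<^sub>M prob_algebra (count_space UNIV)"
    and joint: "\<And>A D. D \<in> sets N \<Longrightarrow> emeasure M {\<omega>\<in>space M. S \<omega> \<in> A \<and> V \<omega> \<in> D} =
        (\<integral>\<^sup>+ w\<in>D. emeasure (K w) A \<partial>(distr M N V))"
    using cd unfolding is_cond_distr_def by auto
  define D where "D A = b -` {A} \<inter> space N" for A
  define H where "H A = {\<omega>\<in>space M. S \<omega> \<in> A \<and> V \<omega> \<in> D A}" for A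
  have D: "D A \<in> sets N" for A
    unfolding D_def using b by (rule measurable_sets) simp
  have H: "H A \<in> sets M" for A
  proof -
    have "H A = (S -` A \<inter> space M) \<inter> (V -` D A \<inter> space M)"
      by (auto simp: H_def)
    then show ?thesis
      using measurable_sets[OF S, of A] measurable_sets[OF V D[of A]] by simp
  qed
  have G: "?G = (\<Union>A. H A)"
    using measurable_space[OF V] by (auto simp: H_def D_def)
  show "?G \<in> sets M"
    unfolding G using H by (intro sets.finite_UN) auto
  have dH: "disjoint_family H" and dD: "disjoint_family D"
    by (auto simp: disjoint_family_on_def H_def D_def)
  interpret V: prob_space "distr M N V"
    by (rule prob_space_distr[OF V])
  \<comment> \<open>On \<open>D A\<close> the set \<open>b w\<close> equals \<open>A\<close>, so
    \<open>level\<close> bounds the integrand there.\<close>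
  have le: "ennreal \<alpha> * emeasure (distr M N V) (D A) \<le> emeasure M (H A)" for A
  proof -
    have "ennreal \<alpha> * emeasure (distr M N V) (D A) = (\<integral>\<^sup>+ w\<in>D A. ennreal \<alpha> \<partial>(distr M N V))"
      using D by (simp add: nn_integral_cmult_indicator)
    also have "\<dots> \<le> (\<integral>\<^sup>+ w\<in>D A. emeasure (K w) A \<partial>(distr M N V))"
    proof (rule nn_integral_mono)
      fix w assume "w \<in> space (distr M N V)"
      then have w: "w \<in> space N" by simp
      interpret Kw: prob_space "K w"
        using measurable_space[OF K w] by (simp add: space_prob_algebra)
      show "ennreal \<alpha> * indicator (D A) w \<le> emeasure (K w) A * indicator (D A) w"
        using level[OF w] by (auto simp: indicator_def D_def Kw.emeasure_eq_measure ennreal_leI)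
    qed
    also have "\<dots> = emeasure M (H A)"
      unfolding H_def by (rule joint[OF D, symmetric])
    finally show ?thesis .
  qed
  \<comment> \<open>The pieces \<open>D A\<close> partition the space of \<open>N\<close>; their
    masses add up to 1.\<close>
  have "ennreal \<alpha> = ennreal \<alpha> * emeasure (distr M N V) (\<Union>A. D A)"
  proof -
    have "(\<Union>A. D A) = space (distr M N V)"
      by (auto simp: D_def)
    then show ?thesis
      by (simp add: V.emeasure_space_1 del: space_distr)
  qed
  also have "\<dots> = (\<Sum>A\<in>UNIV. ennreal \<alpha> * emeasure (distr M N V) (D A))"
    using D dD by (subst sum_emeasure[symmetric]) (auto simp: sum_distrib_left)
  also have "\<dots> \<le> (\<Sum>A\<in>UNIV. emeasure M (H A))"
    by (intro sum_mono le)
  also have "\<dots> = emeasure M ?G"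
    unfolding G using H dH by (intro sum_emeasure) auto
  finally show "\<alpha> \<le> measure M ?G"
    by (simp add: emeasure_eq_measure)
qed

section \<open>Measurability of the selected model\<close>

lemma continuous_on_submatrix_mult:
  "continuous_on UNIV (\<lambda>b :: real ^ 'p. submatrix_mult X \<tau> (restrict (($) b) \<tau>))"
  unfolding submatrix_mult_def by (auto intro!: continuous_intros)

text \<open>The infimum is over an uncountable family, but of functions continuous in
  \<open>y\<close>; its strict sublevel sets are therefore unions of open sets.\<close>

lemma borel_measurable_least_squares:
  fixes X :: "real ^ 'p ^ 'n"
  shows "(\<lambda>y. least_squares X y \<tau>) \<in> borel_measurable borel"
  unfolding borel_measurable_iff_less
proof
  fix a
  have "{y. least_squares X y \<tau> < a} =
      (\<Union>\<beta>\<in>\<tau> \<rightarrow>\<^sub>E UNIV. {y. (norm (y - submatrix_mult X \<tau> \<beta>))\<^sup>2 < a})"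
  proof -
    have "(\<tau> \<rightarrow>\<^sub>E (UNIV :: real set)) \<noteq> {}"
      by (simp add: PiE_eq_empty_iff)
    moreover have "bdd_below ((\<lambda>\<beta>. (norm (y - submatrix_mult X \<tau> \<beta>))\<^sup>2) ` (\<tau> \<rightarrow>\<^sub>E UNIV))" for y
      by (rule bdd_belowI[of _ 0]) auto
    ultimately show ?thesis
      by (auto simp: least_squares_def cINF_less_iff)
  qed
  also have "open \<dots>"
    by (intro open_UN ballI open_Collect_less continuous_intros)
  finally show "{y \<in> space borel. least_squares X y \<tau> < a} \<in> sets borel"
    by simp
qed

text \<open>The set of minimizers has finitely many possible values, each determined by finitely
  many comparisons of measurable functions. Any \<open>tie\<close> is then measurable on the
  discrete space of such values.\<close>

lemma measurable_model_estimate: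
  fixes X :: "real ^ 'p ^ 'n"
  shows "model_estimate X tie k \<in> borel \<rightarrow>\<^sub>M count_space UNIV"
proof -
  note [measurable] = borel_measurable_least_squares
  have "(\<lambda>y. {\<tau>. is_arg_min (least_squares X y) (\<lambda>\<tau>'. card \<tau>' \<le> k) \<tau>})
      \<in> borel \<rightarrow>\<^sub>M count_space UNIV" (is "?m \<in> _")
    unfolding measurable_count_space_eq2[OF finite_class.finite_UNIV]
  proof (intro conjI ballI)
    fix A :: "'p set set"
    have "{y\<in>space borel. \<forall>\<tau>\<in>UNIV. is_arg_min (least_squares X y) (\<lambda>\<tau>'. card \<tau>' \<le> k) \<tau> \<longleftrightarrow> \<tau> \<in> A} \<in> sets borel"
    proof (rule sets.sets_Collect_finite_All[OF _ finite_class.finite_UNIV])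
      fix \<tau> :: "'p set"
      have "{y\<in>space borel. \<exists>\<tau>'\<in>UNIV. card \<tau>' \<le> k \<and> least_squares X y \<tau>' < least_squares X y \<tau>} \<in> sets borel"
        by (rule sets.sets_Collect_finite_Ex[OF _ finite_class.finite_UNIV]) measurable
      then have [measurable]: "Measurable.pred borel (\<lambda>y. \<exists>\<tau>'. card \<tau>' \<le> k \<and> least_squares X y \<tau>' < least_squares X y \<tau>)"
        by (simp add: pred_def)
      show "{y\<in>space borel. is_arg_min (least_squares X y) (\<lambda>\<tau>'. card \<tau>' \<le> k) \<tau> \<longleftrightarrow> \<tau> \<in> A} \<in> sets borel"
        unfolding is_arg_min_def by measurable
    qed
    also have "{y\<in>space borel. \<forall>\<tau>\<in>UNIV. is_arg_min (least_squares X y) (\<lambda>\<tau>'. card \<tau>' \<le> k) \<tau> \<longleftrightarrow> \<tau> \<in> A}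
        = ?m -` {A} \<inter> space borel"
      by auto
    finally show "?m -` {A} \<inter> space borel \<in> sets borel" .
  qed simp
  from measurable_compose[OF this, of tie "count_space UNIV"] show ?thesis
    by (simp add: model_estimate_def[abs_def])
qed

section \<open>The confidence event as the preimage of a projection\<close>

lemma confidence_event_in_completion:
  fixes X :: "real ^ 'p ^ 'n" and Y :: "'a \<Rightarrow> real ^ 'n"
  assumes M: "finite_measure M" and Y: "Y \<in> borel_measurable M"
    and W: "(\<lambda>(u, \<beta>, \<sigma>). W u (\<tau>, \<beta>, \<sigma>))
         \<in> borel \<Otimes>\<^sub>M (Pi\<^sub>M \<tau> (\<lambda>_. borel) \<Otimes>\<^sub>M restrict_space borel {0<..}) \<rightarrow>\<^sub>M N"
    and B: "B \<tau> \<in> N \<rightarrow>\<^sub>M count_space UNIV"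
  shows "{\<omega>\<in>space M. \<tau> \<in> confidence_set X tie W B (Y \<omega>)} \<in> sets (completion M)"
proof -
  \<comment> \<open>Writing \<open>\<sigma> = exp s\<close> and embedding the coefficients in \<open>real ^ 'p\<close> makes the projected factor a
    Heine--Borel space.\<close>
  let ?\<beta> = "\<lambda>b :: real ^ 'p. restrict (($) b) \<tau>"
  \<comment> \<open>The noise is the unique solution of the model equation for given
    \<open>y\<close>, coefficients and scale, so the projection runs over coefficients and scale
    only.\<close>
  define u where "u = (\<lambda>(y, b, s). (y - submatrix_mult X \<tau> (?\<beta> b)) /\<^sub>R exp s)"
  define Bw where "Bw = (\<lambda>(y, b, s). B \<tau> (W (u (y, b, s)) (\<tau>, ?\<beta> b, exp s)))"
  \<comment> \<open>The nuclear map sees the noise only through the response, which is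
    \<open>y\<close> here; hence the estimate depends on \<open>fst p\<close> alone.\<close>
  define E where "E = {p :: (real ^ 'n) \<times> (real ^ 'p) \<times> real. model_estimate X tie (card \<tau>) (fst p) \<in> Bw p}"
  have "u \<in> borel_measurable borel"
    unfolding u_def case_prod_beta
    by (intro borel_measurable_continuous_onI continuous_intros
        continuous_on_compose2[OF continuous_on_submatrix_mult]) auto
  moreover have "(\<lambda>p :: (real ^ 'n) \<times> (real ^ 'p) \<times> real. ?\<beta> (fst (snd p))) \<in> borel \<rightarrow>\<^sub>M Pi\<^sub>M \<tau> (\<lambda>_. borel)"
    by (intro measurable_restrict borel_measurable_continuous_onI continuous_intros)
  moreover have "(\<lambda>p :: (real ^ 'n) \<times> (real ^ 'p) \<times> real. exp (snd (snd p))) \<in> borel \<rightarrow>\<^sub>M restrict_space borel {0<..}"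
    by (intro measurable_restrict_space2 borel_measurable_continuous_onI continuous_intros) auto
  ultimately have "(\<lambda>p. (u p, ?\<beta> (fst (snd p)), exp (snd (snd p))))
      \<in> borel \<rightarrow>\<^sub>M borel \<Otimes>\<^sub>M (Pi\<^sub>M \<tau> (\<lambda>_. borel) \<Otimes>\<^sub>M restrict_space borel {0<..})"
    by (intro measurable_Pair)
  from measurable_compose[OF measurable_compose[OF this W] B]
  have Bw: "Bw \<in> borel \<rightarrow>\<^sub>M count_space UNIV"
    by (simp add: Bw_def case_prod_beta')
  have est: "(\<lambda>p :: (real ^ 'n) \<times> (real ^ 'p) \<times> real. model_estimate X tie (card \<tau>) (fst p))
      \<in> borel \<rightarrow>\<^sub>M count_space UNIV"
    by (rule measurable_compose[OF _ measurable_model_estimate])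
       (intro borel_measurable_continuous_onI continuous_intros)
  \<comment> \<open>Splitting by the finitely many values of \<open>Bw\<close> replaces membership
    in a varying set by membership in fixed ones.\<close>
  have "E = (\<Union>A. (Bw -` {A} \<inter> space borel) \<inter>
      ((\<lambda>p. model_estimate X tie (card \<tau>) (fst p)) -` A \<inter> space borel))"
    by (auto simp: E_def)
  then have "E \<in> sets borel"
    using measurable_sets[OF Bw] measurable_sets[OF est]
    by (auto intro!: sets.finite_UN)
  moreover have "finite_measure (distr M borel Y)"
    using M Y by (rule finite_measure.finite_measure_distr)
  ultimately have "fst ` E \<in> sets (completion (distr M borel Y))"
    by (rule fst_borel_in_completion) simp
  moreover have "\<tau> \<in> confidence_set X tie W B y \<longleftrightarrow> y \<in> fst ` E" for y
  proof
    assume "\<tau> \<in> confidence_set X tie W B y"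
    then obtain v \<beta> \<sigma> where \<beta>: "\<beta> \<in> \<tau> \<rightarrow>\<^sub>E UNIV" and \<sigma>: "\<sigma> > 0"
      and y: "y = submatrix_mult X \<tau> \<beta> + \<sigma> *\<^sub>R v"
      and est: "model_estimate X tie (card \<tau>) y \<in> B \<tau> (W v (\<tau>, \<beta>, \<sigma>))"
      by (auto simp: confidence_set_def params_def response_def nuclear_map_def)
    \<comment> \<open>Extensionality of \<open>\<beta>\<close> makes the passage to a full vector
      and back lossless.\<close>
    have \<beta>': "?\<beta> (\<chi> j. \<beta> j) = \<beta>"
      using \<beta> by (auto simp: PiE_def extensional_def fun_eq_iff)
    have "u (y, (\<chi> j. \<beta> j), ln \<sigma>) = v"
      unfolding u_def using \<sigma> by (simp add: y \<beta>')
    then have "(y, (\<chi> j. \<beta> j), ln \<sigma>) \<in> E"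
      using est \<sigma> by (simp add: E_def Bw_def \<beta>')
    then show "y \<in> fst ` E" by force
  next
    assume "y \<in> fst ` E"
    then obtain b s where "(y, b, s) \<in> E" by auto
    moreover have "submatrix_mult X \<tau> (?\<beta> b) + exp s *\<^sub>R u (y, b, s) = y"
      by (simp add: u_def)
    ultimately show "\<tau> \<in> confidence_set X tie W B y"
      unfolding confidence_set_def
      by (intro CollectI exI[of _ "u (y, b, s)"] exI[of _ "?\<beta> b"] exI[of _ "exp s"])
         (auto simp: params_def response_def nuclear_map_def E_def Bw_def)
  qed
  \<comment> \<open>The projection is measurable only for the completed law of \<open>Y\<close>.
    Null sets of that law pull back to null sets, so \<open>Y\<close> remains measurable between the
    completions.\<close>
  moreover have "Y \<in> completion M \<rightarrow>\<^sub>M completion (distr M borel Y)"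
  proof (rule completion.measurable_completion2)
    show "Y \<in> completion M \<rightarrow>\<^sub>M distr M borel Y"
      using measurable_completion[OF Y] by simp
    have "distr (completion M) (distr M borel Y) Y = distr M borel Y"
      using distr_completion[OF Y] distr_cong[of "completion M" "completion M" "distr M borel Y" borel Y Y]
      by simp
    then show "null_sets (distr M borel Y) \<subseteq> null_sets (distr (completion M) (distr M borel Y) Y)"
      by simp
  qed
  ultimately show ?thesis
    using measurable_sets[of Y "completion M" "completion (distr M borel Y)" "fst ` E"]
    by (simp add: vimage_def Int_def conj_commute)
qed

theorem theorem7:
  fixes X :: "real ^ 'p ^ 'n"
    and tie :: "'p set set \<Rightarrow> 'p set"
    and M :: "'a measure"
    and U Y :: "'a \<Rightarrow> real ^ 'n"
    and \<tau>\<^sub>0 :: "'p set" and \<beta>\<^sub>0 :: "'p \<Rightarrow> real" and \<sigma>\<^sub>0 :: real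
    and N :: "'w measure"
    and W :: "real ^ 'n \<Rightarrow> 'p param \<Rightarrow> 'w"
    and B :: "'p set \<Rightarrow> 'w \<Rightarrow> 'p set set"
    and K :: "'p param \<Rightarrow> 'w \<Rightarrow> 'p set measure"
    and \<alpha> :: real
  assumes "0 < \<alpha>" and "\<alpha> < 1"
    and tie_breaking: "\<And>S. S \<noteq> {} \<Longrightarrow> tie S \<in> S"
    and "prob_space M"
    and U_std_normal:
      "distributed M lborel U (\<lambda>u. ennreal (\<Prod>i\<in>UNIV. std_normal_density (u $ i)))"
    and "(\<tau>\<^sub>0, \<beta>\<^sub>0, \<sigma>\<^sub>0) \<in> params"
    and Y_data: "\<And>\<omega>. Y \<omega> = submatrix_mult X \<tau>\<^sub>0 \<beta>\<^sub>0 + \<sigma>\<^sub>0 *\<^sub>R U \<omega>"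
    and W_measurable:
      "\<And>\<tau>. (\<lambda>(u, \<beta>, \<sigma>). W u (\<tau>, \<beta>, \<sigma>))
         \<in> borel \<Otimes>\<^sub>M (Pi\<^sub>M \<tau> (\<lambda>_. borel) \<Otimes>\<^sub>M restrict_space borel {0<..}) \<rightarrow>\<^sub>M N"
    and B_measurable: "\<And>\<tau>. B \<tau> \<in> N \<rightarrow>\<^sub>M count_space UNIV"
    and cond_distr:
      "\<And>\<theta>. \<theta> \<in> params \<Longrightarrow>
         is_cond_distr M (\<lambda>\<omega>. nuclear_map X tie (U \<omega>) \<theta>) N (\<lambda>\<omega>. W (U \<omega>) \<theta>) (K \<theta>)"
    and cond_distr_free:
      "\<And>\<tau> \<beta> \<sigma> \<beta>' \<sigma>' w. (\<tau>, \<beta>, \<sigma>) \<in> params \<Longrightarrow> (\<tau>, \<beta>', \<sigma>') \<in> params \<Longrightarrow> w \<in> space N \<Longrightarrow>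
         K (\<tau>, \<beta>, \<sigma>) w = K (\<tau>, \<beta>', \<sigma>') w"
    and B_level:
      "\<And>\<tau> \<beta> \<sigma> w. (\<tau>, \<beta>, \<sigma>) \<in> params \<Longrightarrow> w \<in> space N \<Longrightarrow>
         \<alpha> \<le> measure (K (\<tau>, \<beta>, \<sigma>) w) (B \<tau> w)"
  shows "\<alpha> \<le> measure (completion M) {\<omega>\<in>space M. \<tau>\<^sub>0 \<in> confidence_set X tie W B (Y \<omega>)}"
proof -
  interpret prob_space M by fact
  let ?\<theta> = "(\<tau>\<^sub>0, \<beta>\<^sub>0, \<sigma>\<^sub>0)"
  let ?C = "{\<omega>\<in>space M. \<tau>\<^sub>0 \<in> confidence_set X tie W B (Y \<omega>)}"
  let ?G = "{\<omega>\<in>space M. nuclear_map X tie (U \<omega>) ?\<theta> \<in> B \<tau>\<^sub>0 (W (U \<omega>) ?\<theta>)}"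
  have U: "U \<in> borel_measurable M"
    using distributed_measurable[OF U_std_normal] by simp
  have "Y = (\<lambda>\<omega>. submatrix_mult X \<tau>\<^sub>0 \<beta>\<^sub>0 + \<sigma>\<^sub>0 *\<^sub>R U \<omega>)"
    using Y_data by auto
  then have "Y \<in> borel_measurable M"
    using U by simp
  then have C: "?C \<in> sets (completion M)"
    by (rule confidence_event_in_completion[OF finite_measure_axioms _ W_measurable B_measurable])
  note G = cond_distr_level[OF \<open>prob_space M\<close> cond_distr[OF \<open>?\<theta> \<in> params\<close>] B_measurable
      B_level[OF \<open>?\<theta> \<in> params\<close>]]
  interpret completion: prob_space "completion M"
    by (rule prob_space_completion)
  \<comment> \<open>\<open>?G\<close> already lies in \<open>sets M\<close>, where the completion
    leaves measures unchanged.\<close>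
  have "\<alpha> \<le> measure (completion M) ?G"
    using G by simp
  also have "\<dots> \<le> measure (completion M) ?C"
  proof (rule completion.finite_measure_mono[OF _ C])
    show "?G \<subseteq> ?C"
      using \<open>?\<theta> \<in> params\<close> by (auto simp: confidence_set_def response_def Y_data)
  qed
  finally show ?thesis .
qed

end
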